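(* Let $C$ be an $n\times n$ non-singular matrix and suppose $A=C-\alpha\,\mathbf u\mathbf v^T$ is singular with $A\mathbf u=A^T\mathbf v=\mathbf 0$, $\mathbf v^T\mathbf u=1$, and $u_n>0$, $v_n>0$, where $\alpha$ is a scalar and $\mathbf u,\mathbf v$ are $n$-vectors. Partition $$A=\begin{bmatrix}A_{11}&\mathbf a_{12}\\ \mathbf a_{21}^T&a_{nn}\end{bmatrix},\quad \mathbf u=\begin{bmatrix}\mathbf u_1\\ u_n\end{bmatrix},\quad \mathbf v=\begin{bmatrix}\mathbf v_1\\ v_n\end{bmatrix}.$$ Then: (a) The right and left nullspaces of $A$ are $\mathrm{nullsp}(A)=\mathrm{span}(\mathbf u)$ and $\mathrm{nullsp}(A^T)=\mathrm{span}(\mathbf v)$. The Moore-Penrose pseudo-inverse of $A$ is $$A^\dagger=B:=\left(I_n-\frac{1}{\mathbf u^T\mathbf u}\mathbf u\mathbf u^T\right)C^{-1}\left(I_n-\frac1{\mathbf v^T\mathbf v}\mathbf v\mathbf v^T\right) =C^{-1}-\frac1{\mathbf u^T\mathbf u}\mathbf u\mathbf y^T-\frac1{\mathbf v^T\mathbf v}\mathbf x\mathbf v^T+\frac{\mathbf u^T\mathbf x}{(\mathbf u^T\mathbf u)(\mathbf v^T\mathbf v)}\mathbf u\mathbf v^T,$$ where $\mathbf y^T=\mathbf u^TC^{-1}$ and $\mathbf x=C^{-1}\mathbf v$. (b) $A_{11}^{-1}$ exists and can be written in terms of $A^\dagger=B=\begin{bmatrix}B_{11}&\mathbf b_{12}\\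 \mathbf b_{21}^T&b_{nn}\end{bmatrix}$, $\mathbf u$, $\mathbf v$ as $$\begin{aligned}A_{11}^{-1}&=\left(I_{n-1}+\frac1{u_n^2}\mathbf u_1\mathbf u_1^T\right)B_{11}\left(I_{n-1}+\frac1{v_n^2}\mathbf v_1\mathbf v_1^T\right)\\ &=\begin{bmatrix}I_{n-1},&-\mathbf u_1/u_n\end{bmatrix}B\begin{bmatrix}I_{n-1}\\-\mathbf v_1^T/v_n\end{bmatrix}\\ &=B_{11}-\frac1{u_n}\mathbf u_1\mathbf b_{21}^T-\frac1{v_n}\mathbf b_{12}\mathbf v_1^T+\frac{b_{nn}}{u_nv_n}\mathbf u_1\mathbf v_1^T .\end{aligned}$$ (c) $A$ and $B=A^\dagger$ can be written in terms of $A_{11}$, $\mathbf u$, $\mathbf v$ as $$A=\begin{bmatrix}A_{11}&-\frac1{u_n}A_{11}\mathbf u_1\\-\frac1{v_n}\mathbf v_1^TA_{11}&\frac{\mathbf v_1^TA_{11}\mathbf u_1}{u_nv_n}\end{bmatrix} =\begin{bmatrix}I_{n-1}\\-\frac1{v_n}\mathbf v_1^T\end{bmatrix}A_{11}\begin{bmatrix}I_{n-1},&-\frac1{u_n}\mathbf u_1\end{bmatrix},$$ $$B=\begin{bmatrix}B_{11}&\mathbf b_{12}\\ \mathbf b_{21}^T&b_{nn}\end{bmatrix} =\begin{bmatrix}I_{n-1}-\frac{\mathbf u_1\mathbf u_1^T}{\mathbf u^T\mathbf u}\\-\frac{u_n}{\mathbf u^T\mathbf u}\mathbf u_1^T\end{bmatrix}A_{11}^{-1}\begin{bmatrix}I_{n-1}-\frac{\mathbf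 v_1\mathbf v_1^T}{\mathbf v^T\mathbf v},&-\frac{v_n}{\mathbf v^T\mathbf v}\mathbf v_1\end{bmatrix},$$ where the individual blocks of $B$ are $$\begin{aligned} B_{11}&=A_{11}^{-1}-\mathbf u_1\mathbf t^T-\mathbf w\mathbf v_1^T+\frac{\mathbf u_1^T\mathbf w}{\mathbf u^T\mathbf u}\,\mathbf u_1\mathbf v_1^T,\\ \mathbf b_{12}&=v_n\frac{\mathbf u_1^T\mathbf w}{\mathbf u^T\mathbf u}\,\mathbf u_1-v_n\mathbf w,\\ \mathbf b_{21}^T&=u_n\frac{\mathbf u_1^T\mathbf w}{\mathbf u^T\mathbf u}\,\mathbf v_1^T-u_n\mathbf t^T,\\ b_{nn}&=u_nv_n\frac{\mathbf u_1^T\mathbf w}{\mathbf u^T\mathbf u}, \end{aligned}$$ with $\mathbf w=\frac1{\mathbf v^T\mathbf v}A_{11}^{-1}\mathbf v_1$ and $\mathbf t^T=\frac1{\mathbf u^T\mathbf u}\mathbf u_1^TA_{11}^{-1}$.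
   Context: All matrices and vectors are real, and $n\ge 2$. In the partitions, $A_{11}$ and $B_{11}$ are the leading $(n-1)\times(n-1)$ principal submatrices, $\mathbf a_{12},\mathbf a_{21},\mathbf b_{12},\mathbf b_{21},\mathbf u_1,\mathbf v_1$ are column vectors of length $n-1$, and $a_{nn},b_{nn},u_n,v_n$ are scalars. $I_m$ is the identity matrix of order $m$, and $\dagger$ denotes the Moore-Penrose pseudo-inverse. *)

theory Defs
  imports
    "Jordan_Normal_Form.Gauss_Jordan_Elimination"
    "Jordan_Normal_Form.Matrix_Kernel"
begin

text \<open>The value is meaningful only for invertible square matrices; see \<open>inv_mat_inverts\<close>.\<close>

definition inv_mat :: "'a :: field mat \<Rightarrow> 'a mat" where
  "inv_mat A = the (mat_inverse A)"

lemma inv_mat_inverts: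
  assumes A: "A \<in> carrier_mat n n" and inv: "invertible_mat A"
  shows "inv_mat A \<in> carrier_mat n n" "A * inv_mat A = 1\<^sub>m n" "inv_mat A * A = 1\<^sub>m n"
proof -
  from inv obtain X where 1: "A * X = 1\<^sub>m n" and "X * A = 1\<^sub>m (dim_row X)"
    using A unfolding invertible_mat_def inverts_mat_def by auto
  moreover have "dim_col X = n"
    using arg_cong[OF 1, of dim_col] by simp
  moreover have "dim_row X = n"
    using arg_cong[OF \<open>X * A = 1\<^sub>m (dim_row X)\<close>, of dim_col] A by simp
  ultimately have "A \<in> Units (ring_mat TYPE('a) n ())"
    using A unfolding Units_def ring_mat_def by auto
  then obtain Y where Y: "mat_inverse A = Some Y"
    using mat_inverse(1)[OF A, of "()"] by (cases "mat_inverse A") auto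
  then show "inv_mat A \<in> carrier_mat n n" "A * inv_mat A = 1\<^sub>m n" "inv_mat A * A = 1\<^sub>m n"
    using mat_inverse(2)[OF A Y] unfolding inv_mat_def by auto
qed

text \<open>The four Penrose conditions for real matrices.\<close>

definition is_pseudo_inverse :: "real mat \<Rightarrow> real mat \<Rightarrow> bool" where
  "is_pseudo_inverse A X \<longleftrightarrow>
     X \<in> carrier_mat (dim_col A) (dim_row A) \<and>
     A * X * A = A \<and> X * A * X = X \<and>
     transpose_mat (A * X) = A * X \<and> transpose_mat (X * A) = X * A"

definition pseudo_inverse :: "real mat \<Rightarrow> real mat" where
  "pseudo_inverse A = (THE X. is_pseudo_inverse A X)"

lemma is_pseudo_inverse_unique:
  assumes X: "is_pseudo_inverse A X" and Y: "is_pseudo_inverse A Y"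
  shows "X = Y"
proof -
  define m n where "m = dim_row A" and "n = dim_col A"
  have c: "A \<in> carrier_mat m n" "X \<in> carrier_mat n m" "Y \<in> carrier_mat n m"
    using X Y unfolding is_pseudo_inverse_def m_def n_def by auto
  note X' = X[unfolded is_pseudo_inverse_def] and Y' = Y[unfolded is_pseudo_inverse_def]
  have cXA: "X * A \<in> carrier_mat n n" "Y * A \<in> carrier_mat n n"
    and cAX: "A * X \<in> carrier_mat m m" "A * Y \<in> carrier_mat m m"
    using c by auto
  have "A * X = transpose_mat (A * Y * A * X)"
    using X' Y' by simp
  also have "\<dots> = transpose_mat ((A * Y) * (A * X))"
    using assoc_mult_mat[OF cAX(2) c(1,2)] by simp
  also have "\<dots> = transpose_mat (A * X) * transpose_mat (A * Y)"
    by (rule transpose_mult[OF cAX(2) cAX(1)])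
  also have "\<dots> = (A * X) * (A * Y)"
    using X' Y' by simp
  also have "\<dots> = A * X * A * Y"
    using assoc_mult_mat[OF cAX(1) c(1,3)] by simp
  finally have AX: "A * X = A * Y" using X' by simp
  have "X * A = transpose_mat (X * (A * Y * A))"
    using X' Y' by simp
  also have "\<dots> = transpose_mat ((X * A) * (Y * A))"
    using c cXA assoc_mult_mat[OF c(1,3,1)] assoc_mult_mat[OF c(2,1) cXA(2)] by simp
  also have "\<dots> = transpose_mat (Y * A) * transpose_mat (X * A)"
    by (rule transpose_mult[OF cXA(1,2)])
  also have "\<dots> = (Y * A) * (X * A)"
    using X' Y' by simp
  also have "\<dots> = Y * (A * X * A)"
    using assoc_mult_mat[OF c(1,2,1)] assoc_mult_mat[OF c(3,1) cXA(1)] by simp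
  finally have XA: "X * A = Y * A" using X' by simp
  have "X = X * A * X" using X' by simp
  also have "\<dots> = Y * A * X" using XA by simp
  also have "\<dots> = Y * (A * X)" using assoc_mult_mat[OF c(3,1,2)] by simp
  also have "\<dots> = Y * A * Y" using AX assoc_mult_mat[OF c(3,1,3)] by simp
  also have "\<dots> = Y" using Y' by simp
  finally show ?thesis .
qed

lemma pseudo_inverse_eqI: "is_pseudo_inverse A X \<Longrightarrow> pseudo_inverse A = X"
  unfolding pseudo_inverse_def using is_pseudo_inverse_unique by blast

definition outer_prod :: "'a :: semiring_0 vec \<Rightarrow> 'a vec \<Rightarrow> 'a mat" where
  "outer_prod x y = mat (dim_vec x) (dim_vec y) (\<lambda>(i, j). x $ i * y $ j)"

abbreviation mat_of_col :: "'a vec \<Rightarrow> 'a mat" where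
  "mat_of_col x \<equiv> mat_of_cols (dim_vec x) [x]"

definition append_cols :: "'a :: zero mat \<Rightarrow> 'a mat \<Rightarrow> 'a mat" (infixr \<open>@\<^sub>c\<close> 65) where
  "A @\<^sub>c B = four_block_mat A B (0\<^sub>m 0 (dim_col A)) (0\<^sub>m 0 (dim_col B))"

text \<open>\<open>bordered_mat M b c d\<close> has leading block \<open>M\<close>, last column \<open>(b, d)\<close> and last row
  \<open>(c\<^sup>T, d)\<close>.\<close>

definition bordered_mat :: "'a mat \<Rightarrow> 'a vec \<Rightarrow> 'a vec \<Rightarrow> 'a \<Rightarrow> 'a mat" where
  "bordered_mat M b c d = four_block_mat M (mat_of_col b) (mat_of_row c) (mat 1 1 (\<lambda>_. d))"

abbreviation real_span :: "nat \<Rightarrow> real vec set \<Rightarrow> real vec set" where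
  "real_span n \<equiv> LinearCombinations.module.span class_ring (module_vec TYPE(real) n)"

end

theory Submission
  imports Defs
begin

text \<open>
  Let \<open>X = inv_mat C\<close>. Because \<open>A u = 0\<close> and \<open>v \<bullet> u = 1\<close>, the vector \<open>u\<close> is an eigenvector
  of \<open>C\<close> with eigenvalue \<open>\<alpha>\<close>, and symmetrically \<open>v\<close> is one of the transpose of \<open>C\<close>. Hence
  \<open>X A = A X = I - u v\<^sup>T\<close> (\<open>rank_one_perturbed_inverse\<close> and its transposed form). This oblique
  projector shows at once that the null spaces are the lines through \<open>u\<close> and \<open>v\<close>. Let \<open>P\<close>
  and \<open>Q\<close> be the projectors onto the orthogonal complements of \<open>u\<close> and \<open>v\<close>. Since \<open>A P = A\<close>
  and \<open>v\<^sup>T Q = 0\<close>, the matrix \<open>B = P X Q\<close> satisfies \<open>A B = Q\<close> and, likewise, \<open>B A = P\<close>. These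
  are symmetric, so \<open>B\<close> is the pseudo-inverse (\<open>projected_inverse\<close>).

  For the leading block, let \<open>L = [I, -u1 / un]\<close> and let \<open>R\<close> be the transpose of
  \<open>[I, -v1 / vn]\<close>. The null vectors of \<open>A\<close> express its last row and column through \<open>A11\<close>,
  which is the factorization \<open>A = R A11 L\<close> (\<open>bordered_null_blocks\<close>, \<open>bordered_factorization\<close>).
  Then \<open>R (A11 L B R) = A B R = Q R = R\<close>, since \<open>v\<close> is orthogonal to the columns of \<open>R\<close>.
  Cancelling \<open>R\<close>, which has the identity on top, shows that \<open>L B R\<close> is the inverse of \<open>A11\<close>
  (\<open>leading_block_inverse\<close>). Multiplying out gives the expanded formula for this inverse
  (\<open>eliminate_both_sides_bordered\<close>). The null vectors of \<open>B\<close> express its last row and column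
  through \<open>B11\<close>, which turns the expanded formula into the product formula.

  Conversely, let \<open>S\<close> consist of the first \<open>n - 1\<close> columns of \<open>P\<close> and \<open>T\<close> of the first
  \<open>n - 1\<close> rows of \<open>Q\<close>. Then \<open>S L = P\<close> and \<open>R T = Q\<close>
  (\<open>orth_proj_leading_mult_eliminate_last\<close>), so \<open>B = P B Q = S (L B R) T\<close>, and multiplying out
  yields the blocks of \<open>B\<close> (\<open>orth_proj_leading_sandwich\<close>).
\<close>

section \<open>Outer products and rank-one updates\<close>

lemma dim_outer_prod [simp]:
  "dim_row (outer_prod x y) = dim_vec x" "dim_col (outer_prod x y) = dim_vec y"
  by (simp_all add: outer_prod_def)

lemma index_outer_prod [simp]:
  "i < dim_vec x \<Longrightarrow> j < dim_vec y \<Longrightarrow> outer_prod x y $$ (i, j) = x $ i * y $ j"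
  by (simp add: outer_prod_def)

lemma outer_prod_carrier [simp]:
  "outer_prod x y \<in> carrier_mat n k \<longleftrightarrow> x \<in> carrier_vec n \<and> y \<in> carrier_vec k"
  by (metis carrier_matD carrier_matI carrier_vecD carrier_vecI dim_outer_prod)

lemma smult_outer_prod:
  fixes x :: "'a :: comm_semiring_0 vec"
  shows "c \<cdot>\<^sub>m outer_prod x y = outer_prod (c \<cdot>\<^sub>v x) y"
    and "c \<cdot>\<^sub>m outer_prod x y = outer_prod x (c \<cdot>\<^sub>v y)"
  by (auto intro!: eq_matI simp: ac_simps)

lemma mult_outer_prod:
  fixes A :: "'a :: comm_semiring_0 mat"
  assumes "A \<in> carrier_mat nr n" "x \<in> carrier_vec n"
  shows "A * outer_prod x y = outer_prod (A *\<^sub>v x) y"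
  using assms
  by (intro eq_matI) (auto simp: outer_prod_def scalar_prod_def sum_distrib_right mult.assoc)

lemma outer_prod_mult:
  fixes A :: "'a :: comm_semiring_0 mat"
  assumes "A \<in> carrier_mat n nc" "y \<in> carrier_vec n"
  shows "outer_prod x y * A = outer_prod x (transpose_mat A *\<^sub>v y)"
  using assms
  by (intro eq_matI) (auto simp: outer_prod_def scalar_prod_def sum_distrib_left ac_simps)

lemma outer_prod_mult_vec:
  fixes x :: "'a :: comm_semiring_0 vec"
  assumes "y \<in> carrier_vec n" "z \<in> carrier_vec n"
  shows "outer_prod x y *\<^sub>v z = (y \<bullet> z) \<cdot>\<^sub>v x"
  using assms
  by (intro eq_vecI) (auto simp: outer_prod_def scalar_prod_def sum_distrib_left sum_distrib_right ac_simps)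

text \<open>Projectors are written with a minus sign; this brings them into the form of the
  rank-one update lemmas.\<close>

lemma rank_one_downdate_eq:
  fixes u :: "'a :: comm_ring_1 vec"
  assumes "u \<in> carrier_vec n" "v \<in> carrier_vec n"
  shows "1\<^sub>m n - c \<cdot>\<^sub>m outer_prod u v = 1\<^sub>m n + (- c) \<cdot>\<^sub>m outer_prod u v"
  using assms by (intro eq_matI) auto

lemma rank_one_update_mult_vec:
  fixes z :: "'a :: comm_ring_1 vec"
  assumes "p \<in> carrier_vec n" "q \<in> carrier_vec n" "z \<in> carrier_vec n"
  shows "(1\<^sub>m n + a \<cdot>\<^sub>m outer_prod p q) *\<^sub>v z = z + (a * (q \<bullet> z)) \<cdot>\<^sub>v p"
  using assms
  by (subst add_mult_distrib_mat_vec[of _ n n])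
     (auto simp: smult_outer_prod(1) outer_prod_mult_vec[of _ n] smult_smult_assoc mult.commute)

text \<open>The expansion of the pseudo-inverse, the product formula for the inverse of the leading
  block and the leading block of the pseudo-inverse are all instances of this identity.\<close>

lemma rank_one_update_mult_both:
  fixes M :: "'a :: comm_ring_1 mat"
  assumes M: "M \<in> carrier_mat n k"
    and pq: "p \<in> carrier_vec n" "q \<in> carrier_vec n"
    and rs: "r \<in> carrier_vec k" "s \<in> carrier_vec k"
  shows "(1\<^sub>m n + a \<cdot>\<^sub>m outer_prod p q) * M * (1\<^sub>m k + b \<cdot>\<^sub>m outer_prod r s)
    = M + a \<cdot>\<^sub>m outer_prod p (transpose_mat M *\<^sub>v q) + b \<cdot>\<^sub>m outer_prod (M *\<^sub>v r) s
        + (a * b * (q \<bullet> (M *\<^sub>v r))) \<cdot>\<^sub>m outer_prod p s"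
proof -
  define y where "y = transpose_mat M *\<^sub>v q"
  have y: "y \<in> carrier_vec k" using M pq by (simp add: y_def)
  have "(1\<^sub>m n + a \<cdot>\<^sub>m outer_prod p q) * M = M + a \<cdot>\<^sub>m outer_prod p y"
    using M pq
    by (subst add_mult_distrib_mat[of _ n n])
       (auto simp: y_def mult_smult_assoc_mat[of _ n n _ k] outer_prod_mult[of _ n k])
  moreover have "(M + a \<cdot>\<^sub>m outer_prod p y) * (1\<^sub>m k + b \<cdot>\<^sub>m outer_prod r s)
    = (M + a \<cdot>\<^sub>m outer_prod p y) + b \<cdot>\<^sub>m outer_prod ((M + a \<cdot>\<^sub>m outer_prod p y) *\<^sub>v r) s"
    using M pq rs y
    by (subst mult_add_distrib_mat[of _ n k])
       (auto simp: mult_smult_distrib[of _ n k _ k] mult_outer_prod[of _ n k])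
  moreover have "(M + a \<cdot>\<^sub>m outer_prod p y) *\<^sub>v r = M *\<^sub>v r + (a * (y \<bullet> r)) \<cdot>\<^sub>v p"
    using M pq rs y
    by (intro eq_vecI)
       (auto simp: scalar_prod_def sum_distrib_left sum_distrib_right sum.distrib algebra_simps)
  moreover have "y \<bullet> r = q \<bullet> (M *\<^sub>v r)"
    using M pq rs unfolding y_def by (intro transpose_vec_mult_scalar) auto
  ultimately show ?thesis
    using M pq rs y by (intro eq_matI) (auto simp: algebra_simps y_def[symmetric])
qed

section \<open>Vectors and matrices bordered by one row or column\<close>

text \<open>The one-element vector is written \<open>vCons c vNil\<close> because that is the simp-normal form
  of \<open>vec_of_list [c]\<close>.\<close>

lemma index_append_single:
  "dim_vec (z @\<^sub>v vCons c vNil) = Suc (dim_vec z)"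
  "i < dim_vec z \<Longrightarrow> (z @\<^sub>v vCons c vNil) $ i = z $ i"
  "(z @\<^sub>v vCons c vNil) $ dim_vec z = c"
  by simp_all

lemma append_single_carrier [simp]:
  "z @\<^sub>v vCons c vNil \<in> carrier_vec (Suc k) \<longleftrightarrow> z \<in> carrier_vec k"
  by (metis Suc_inject carrier_vecD carrier_vecI index_append_single(1))

lemma append_single_eq_iff:
  "dim_vec y = dim_vec z \<Longrightarrow>
    y @\<^sub>v vec_of_list [c] = z @\<^sub>v vec_of_list [d] \<longleftrightarrow> y = z \<and> c = d"
  by (subst append_vec_eq[of _ "dim_vec y"]) (auto intro: carrier_vecI)

lemma zero_append_single: "0\<^sub>v (Suc m) = 0\<^sub>v m @\<^sub>v vec_of_list [0]"
  by (intro eq_vecI) (auto simp: less_Suc_eq)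

lemma scalar_prod_append_single:
  fixes y z :: "'a :: semiring_0 vec"
  assumes "y \<in> carrier_vec k" "z \<in> carrier_vec k"
  shows "(y @\<^sub>v vec_of_list [c]) \<bullet> (z @\<^sub>v vec_of_list [d]) = y \<bullet> z + c * d"
  using assms by (auto simp: scalar_prod_def index_append_single)

text \<open>The row count \<open>l\<close> of the appended column stays arbitrary: the simplifier evaluates the
  \<open>dim_vec c\<close> hidden in \<open>mat_of_col c\<close>, so that the literal form \<open>mat_of_col c\<close> would
  no longer match.\<close>

lemma dim_append_row_col [simp]:
  "dim_row (M @\<^sub>r mat_of_row r) = Suc (dim_row M)" "dim_col (M @\<^sub>r mat_of_row r) = dim_col M"
  "dim_row (M @\<^sub>c mat_of_cols l [c]) = dim_row M" "dim_col (M @\<^sub>c mat_of_cols l [c]) = Suc (dim_col M)"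
  by (auto simp: append_rows_def append_cols_def)

lemma dim_bordered_mat [simp]:
  "dim_row (bordered_mat M c r d) = Suc (dim_row M)" "dim_col (bordered_mat M c r d) = Suc (dim_col M)"
  by (auto simp: bordered_mat_def)

lemma index_append_row:
  assumes "M \<in> carrier_mat m k" "r \<in> carrier_vec k" "i < Suc m" "j < k"
  shows "(M @\<^sub>r mat_of_row r) $$ (i, j) = (if i < m then M $$ (i, j) else r $ j)"
  using assms by (auto simp: append_rows_def mat_of_rows_def less_Suc_eq)

lemma index_append_col:
  assumes "M \<in> carrier_mat m k" "c \<in> carrier_vec m" "i < m" "j < Suc k"
  shows "(M @\<^sub>c mat_of_cols m [c]) $$ (i, j) = (if j < k then M $$ (i, j) else c $ i)"
  using assms by (auto simp: append_cols_def mat_of_cols_def less_Suc_eq)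

lemma index_bordered_mat:
  assumes "M \<in> carrier_mat m k" "c \<in> carrier_vec m" "r \<in> carrier_vec k" "i < Suc m" "j < Suc k"
  shows "bordered_mat M c r d $$ (i, j) =
    (if i < m then if j < k then M $$ (i, j) else c $ i else if j < k then r $ j else d)"
  using assms by (auto simp: bordered_mat_def mat_of_rows_def mat_of_cols_def less_Suc_eq)

lemma append_row_carrier [simp]:
  "M @\<^sub>r mat_of_row r \<in> carrier_mat (Suc m) k \<longleftrightarrow> M \<in> carrier_mat m k"
  by (auto intro!: carrier_matI dest: carrier_matD)

lemma append_col_carrier [simp]:
  "M @\<^sub>c mat_of_cols l [c] \<in> carrier_mat m (Suc k) \<longleftrightarrow> M \<in> carrier_mat m k"
  by (auto intro!: carrier_matI dest: carrier_matD)

lemma append_row_eq_iff: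
  assumes "M \<in> carrier_mat m k" "N \<in> carrier_mat m k" "r \<in> carrier_vec k" "s \<in> carrier_vec k"
  shows "M @\<^sub>r mat_of_row r = N @\<^sub>r mat_of_row s \<longleftrightarrow> M = N \<and> r = s"
proof
  assume eq: "M @\<^sub>r mat_of_row r = N @\<^sub>r mat_of_row s"
  have e: "(if i < m then M $$ (i, j) else r $ j) = (if i < m then N $$ (i, j) else s $ j)"
    if "i < Suc m" "j < k" for i j
    using arg_cong[OF eq, of "\<lambda>X. X $$ (i, j)"] assms that by (simp add: index_append_row)
  have "M $$ (i, j) = N $$ (i, j)" if "i < m" "j < k" for i j
    using e[of i j] that by simp
  moreover have "r $ j = s $ j" if "j < k" for j
    using e[of m j] that by simp
  ultimately show "M = N \<and> r = s"
    using assms by (auto intro!: eq_matI eq_vecI)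
qed auto

lemma bordered_mat_eq_iff:
  assumes "M \<in> carrier_mat m k" "N \<in> carrier_mat m k" "b \<in> carrier_vec m" "c \<in> carrier_vec m"
    "r \<in> carrier_vec k" "s \<in> carrier_vec k"
  shows "bordered_mat M b r d = bordered_mat N c s e \<longleftrightarrow> M = N \<and> b = c \<and> r = s \<and> d = e"
proof
  assume eq: "bordered_mat M b r d = bordered_mat N c s e"
  have e: "bordered_mat M b r d $$ (i, j) = bordered_mat N c s e $$ (i, j)" for i j
    using eq by simp
  have "M $$ (i, j) = N $$ (i, j)" if "i < m" "j < k" for i j
    using e[of i j] assms that by (simp add: index_bordered_mat)
  moreover have "b $ i = c $ i" if "i < m" for i
    using e[of i k] assms that by (simp add: index_bordered_mat)
  moreover have "r $ j = s $ j" if "j < k" for j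
    using e[of m j] assms that by (simp add: index_bordered_mat)
  moreover have "d = e"
    using e[of m k] assms by (simp add: index_bordered_mat)
  ultimately show "M = N \<and> b = c \<and> r = s \<and> d = e"
    using assms by (auto intro!: eq_matI eq_vecI)
qed auto

lemma transpose_append_row:
  assumes "M \<in> carrier_mat m k" "r \<in> carrier_vec k"
  shows "transpose_mat (M @\<^sub>r mat_of_row r) = transpose_mat M @\<^sub>c mat_of_col r"
  using assms
  by (intro eq_matI) (auto simp: index_append_row[of _ m k] index_append_col[of _ k m])

lemma transpose_append_col:
  assumes "M \<in> carrier_mat m k" "c \<in> carrier_vec m"
  shows "transpose_mat (M @\<^sub>c mat_of_col c) = transpose_mat M @\<^sub>r mat_of_row c"
  using assms
  by (intro eq_matI) (auto simp: index_append_row[of _ k m] index_append_col[of _ m k])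

lemma transpose_bordered_mat:
  assumes "M \<in> carrier_mat m k" "c \<in> carrier_vec m" "r \<in> carrier_vec k"
  shows "transpose_mat (bordered_mat M c r d) = bordered_mat (transpose_mat M) r c d"
  using assms
  by (intro eq_matI) (auto simp: index_bordered_mat[of _ m k] index_bordered_mat[of _ k m])

lemma bordered_mat_eq_append_col:
  assumes "M \<in> carrier_mat m k" "c \<in> carrier_vec m" "r \<in> carrier_vec k"
  shows "bordered_mat M c r d = (M @\<^sub>r mat_of_row r) @\<^sub>c mat_of_col (c @\<^sub>v vec_of_list [d])"
  using assms
  by (intro eq_matI)
     (auto simp: index_bordered_mat[of _ m k] index_append_col[of _ "Suc m" k]
       index_append_row[of _ m k] index_append_single less_Suc_eq)

lemma bordered_mat_eq_append_row:
  assumes "M \<in> carrier_mat m k" "c \<in> carrier_vec m" "r \<in> carrier_vec k"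
  shows "bordered_mat M c r d = (M @\<^sub>c mat_of_col c) @\<^sub>r mat_of_row (r @\<^sub>v vec_of_list [d])"
  using assms
  by (intro eq_matI)
     (auto simp: index_bordered_mat[of _ m k] index_append_col[of _ m k]
       index_append_row[of _ m "Suc k"] index_append_single less_Suc_eq)

lemma append_row_mult:
  fixes M :: "'a :: comm_semiring_0 mat"
  assumes "M \<in> carrier_mat m k" "r \<in> carrier_vec k" "N \<in> carrier_mat k l"
  shows "(M @\<^sub>r mat_of_row r) * N = (M * N) @\<^sub>r mat_of_row (transpose_mat N *\<^sub>v r)"
  using assms
  by (intro eq_matI)
     (auto simp: index_append_row[of _ m k] index_append_row[of _ m l] scalar_prod_def ac_simps)

lemma mult_append_col:
  fixes M :: "'a :: comm_semiring_0 mat"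
  assumes "M \<in> carrier_mat m k" "c \<in> carrier_vec k" "N \<in> carrier_mat k l"
  shows "M * (N @\<^sub>c mat_of_col c) = (M * N) @\<^sub>c mat_of_col (M *\<^sub>v c)"
  using assms
  by (intro eq_matI)
     (auto simp: index_append_col[of _ m l] index_append_col[of _ k l] scalar_prod_def)

lemma append_col_mult_append_row:
  fixes M :: "'a :: comm_semiring_0 mat"
  assumes "M \<in> carrier_mat m k" "c \<in> carrier_vec m" "N \<in> carrier_mat k l" "r \<in> carrier_vec l"
  shows "(M @\<^sub>c mat_of_col c) * (N @\<^sub>r mat_of_row r) = M * N + outer_prod c r"
  using assms
  by (intro eq_matI)
     (auto simp: index_append_col[of _ m k] index_append_row[of _ k l] scalar_prod_def)

lemma append_row_mult_vec:
  fixes M :: "'a :: comm_semiring_0 mat"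
  assumes "M \<in> carrier_mat m k" "r \<in> carrier_vec k" "z \<in> carrier_vec k"
  shows "(M @\<^sub>r mat_of_row r) *\<^sub>v z = (M *\<^sub>v z) @\<^sub>v vec_of_list [r \<bullet> z]"
  using assms
  by (intro eq_vecI)
     (auto simp: index_append_row[of _ m k] scalar_prod_def index_append_single less_Suc_eq)

lemma append_col_mult_vec:
  fixes M :: "'a :: comm_semiring_0 mat"
  assumes "M \<in> carrier_mat m k" "c \<in> carrier_vec m" "z \<in> carrier_vec k"
  shows "(M @\<^sub>c mat_of_col c) *\<^sub>v (z @\<^sub>v vec_of_list [d]) = M *\<^sub>v z + d \<cdot>\<^sub>v c"
  using assms
  by (intro eq_vecI)
     (auto simp: index_append_col[of _ m k] scalar_prod_def index_append_single mult.commute)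

lemma bordered_mat_mult_vec:
  fixes M :: "'a :: comm_semiring_0 mat"
  assumes "M \<in> carrier_mat m k" "c \<in> carrier_vec m" "r \<in> carrier_vec k" "z \<in> carrier_vec k"
  shows "bordered_mat M c r d *\<^sub>v (z @\<^sub>v vec_of_list [e])
    = (M *\<^sub>v z + e \<cdot>\<^sub>v c) @\<^sub>v vec_of_list [r \<bullet> z + d * e]"
  using assms
  by (intro eq_vecI)
     (auto simp: index_bordered_mat[of _ m k] scalar_prod_def index_append_single less_Suc_eq mult.commute)

section \<open>The projector onto the orthogonal complement of a vector\<close>

definition orth_proj :: "nat \<Rightarrow> real vec \<Rightarrow> real mat" where
  "orth_proj n u = 1\<^sub>m n - (1 / (u \<bullet> u)) \<cdot>\<^sub>m outer_prod u u"

lemma orth_proj_carrier [simp]: "u \<in> carrier_vec n \<Longrightarrow> orth_proj n u \<in> carrier_mat n n"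
  by (simp add: orth_proj_def minus_carrier_mat)

lemma dim_orth_proj [simp]:
  "dim_row (orth_proj n u) = dim_vec u" "dim_col (orth_proj n u) = dim_vec u"
  by (simp_all add: orth_proj_def)

lemma transpose_orth_proj:
  "u \<in> carrier_vec n \<Longrightarrow> transpose_mat (orth_proj n u) = orth_proj n u"
  unfolding orth_proj_def by (intro eq_matI) (auto simp: mult.commute)

lemma orth_proj_mult_vec_self:
  assumes "u \<in> carrier_vec n" "u \<bullet> u \<noteq> 0"
  shows "orth_proj n u *\<^sub>v u = 0\<^sub>v n"
  using assms unfolding orth_proj_def
  by (subst rank_one_downdate_eq) (auto simp: rank_one_update_mult_vec intro!: eq_vecI)

lemma mult_orth_proj:
  assumes M: "M \<in> carrier_mat k n" and u: "u \<in> carrier_vec n" and 0: "M *\<^sub>v u = 0\<^sub>v k"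
  shows "M * orth_proj n u = M"
proof -
  have "M * orth_proj n u = M - M * ((1 / (u \<bullet> u)) \<cdot>\<^sub>m outer_prod u u)"
    using M u unfolding orth_proj_def by (subst mult_minus_distrib_mat[of _ k n]) auto
  also have "M * ((1 / (u \<bullet> u)) \<cdot>\<^sub>m outer_prod u u) = (1 / (u \<bullet> u)) \<cdot>\<^sub>m outer_prod (M *\<^sub>v u) u"
    using M u by (simp add: mult_smult_distrib[of _ k n _ n] mult_outer_prod[of _ k n])
  also have "M - \<dots> = M"
    unfolding 0 using M u by (intro eq_matI) auto
  finally show ?thesis .
qed

text \<open>The transpose of the previous fact, since the projector is symmetric.\<close>

lemma orth_proj_mult:
  assumes M: "M \<in> carrier_mat n k" and u: "u \<in> carrier_vec n"
    and 0: "transpose_mat M *\<^sub>v u = 0\<^sub>v k"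
  shows "orth_proj n u * M = M"
proof -
  have "transpose_mat (orth_proj n u * M) = transpose_mat M * orth_proj n u"
    using M u by (subst transpose_mult[of _ n n _ k]) (auto simp: transpose_orth_proj)
  also have "\<dots> = transpose_mat M"
    using M u 0 by (intro mult_orth_proj) auto
  finally show ?thesis by simp
qed

lemma orth_proj_idem:
  assumes "u \<in> carrier_vec n" "u \<bullet> u \<noteq> 0"
  shows "orth_proj n u * orth_proj n u = orth_proj n u"
  using assms by (intro mult_orth_proj[of _ n] orth_proj_mult_vec_self) auto

section \<open>Singular rank-one perturbations of an invertible matrix\<close>

text \<open>From \<open>A u = 0\<close> and \<open>v \<bullet> u = 1\<close>, the vector \<open>u\<close> is an eigenvector of \<open>C\<close> for the
  eigenvalue \<open>\<alpha>\<close>. Hence \<open>\<alpha> X u = u\<close>, and the perturbation contributes exactly \<open>u v\<^sup>T\<close>,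
  without any trace of \<open>\<alpha>\<close>. Thus \<open>X A\<close> is the oblique projector that kills \<open>u\<close>.\<close>

lemma rank_one_perturbed_inverse:
  fixes C :: "real mat"
  assumes C: "C \<in> carrier_mat n n" and X: "X \<in> carrier_mat n n" "X * C = 1\<^sub>m n"
    and uv: "u \<in> carrier_vec n" "v \<in> carrier_vec n" "v \<bullet> u = 1"
    and null: "(C - \<alpha> \<cdot>\<^sub>m outer_prod u v) *\<^sub>v u = 0\<^sub>v n"
  shows "X * (C - \<alpha> \<cdot>\<^sub>m outer_prod u v) = 1\<^sub>m n - outer_prod u v"
proof -
  have "C *\<^sub>v u - \<alpha> \<cdot>\<^sub>v u = 0\<^sub>v n"
    using null C uv
    by (subst (asm) minus_mult_distrib_mat_vec[of _ n n])
       (auto simp: smult_outer_prod(1) outer_prod_mult_vec[of _ n])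
  then have Cu: "C *\<^sub>v u = \<alpha> \<cdot>\<^sub>v u"
    using C uv by (auto simp: vec_eq_iff)
  have "u = (X * C) *\<^sub>v u"
    unfolding X(2) using uv by simp
  also have "\<dots> = \<alpha> \<cdot>\<^sub>v (X *\<^sub>v u)"
    using C X(1) uv Cu by (simp add: assoc_mult_mat_vec[of _ n n _ n] mult_mat_vec[of _ n n])
  finally have Xu: "\<alpha> \<cdot>\<^sub>v (X *\<^sub>v u) = u" by simp
  have "X * (C - \<alpha> \<cdot>\<^sub>m outer_prod u v) = X * C - X * (\<alpha> \<cdot>\<^sub>m outer_prod u v)"
    using C X uv by (subst mult_minus_distrib_mat[of _ n n]) auto
  also have "X * (\<alpha> \<cdot>\<^sub>m outer_prod u v) = outer_prod (\<alpha> \<cdot>\<^sub>v (X *\<^sub>v u)) v"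
    using X uv
    by (simp add: mult_smult_distrib[of _ n n _ n] mult_outer_prod[of _ n n] smult_outer_prod(1)
        mult_mat_vec[of _ n n])
  finally show ?thesis
    unfolding Xu X(2) .
qed

text \<open>The previous lemma for the transposed matrices, with \<open>u\<close> and \<open>v\<close> exchanged.\<close>

lemma rank_one_perturbed_inverse_right:
  fixes C :: "real mat"
  assumes C: "C \<in> carrier_mat n n" and X: "X \<in> carrier_mat n n" "C * X = 1\<^sub>m n"
    and uv: "u \<in> carrier_vec n" "v \<in> carrier_vec n" "v \<bullet> u = 1"
    and null: "transpose_mat (C - \<alpha> \<cdot>\<^sub>m outer_prod u v) *\<^sub>v v = 0\<^sub>v n"
  shows "(C - \<alpha> \<cdot>\<^sub>m outer_prod u v) * X = 1\<^sub>m n - outer_prod u v"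
proof -
  let ?A = "C - \<alpha> \<cdot>\<^sub>m outer_prod u v"
  have T: "transpose_mat ?A = transpose_mat C - \<alpha> \<cdot>\<^sub>m outer_prod v u"
    using C uv by (intro eq_matI) auto
  have "transpose_mat X * transpose_mat C = 1\<^sub>m n"
    using C X by (metis transpose_mult transpose_one)
  then have "transpose_mat X * transpose_mat ?A = 1\<^sub>m n - outer_prod v u"
    using null C X uv unfolding T
    by (intro rank_one_perturbed_inverse) (auto simp: comm_scalar_prod[of u n])
  moreover have "transpose_mat (?A * X) = transpose_mat X * transpose_mat ?A"
    using C X uv by (intro transpose_mult[of _ n n]) (auto simp: minus_carrier_mat)
  moreover have "transpose_mat (1\<^sub>m n - outer_prod u v) = 1\<^sub>m n - outer_prod v u"
    using uv by (intro eq_matI) auto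
  ultimately show ?thesis
    by (metis transpose_mat_eq)
qed

lemma mult_mat_zero_vec:
  fixes M :: "'a :: semiring_0 mat"
  shows "M \<in> carrier_mat nr nc \<Longrightarrow> M *\<^sub>v 0\<^sub>v nc = 0\<^sub>v nr"
  by (intro eq_vecI) auto

lemma real_span_singleton:
  assumes u: "u \<in> carrier_vec n"
  shows "real_span n {u} = {c \<cdot>\<^sub>v u | c. True}"
proof -
  interpret vec_space "TYPE(real)" n .
  have comb: "lincomb a {u} = a u \<cdot>\<^sub>v u" for a
    using u unfolding lincomb_def by (subst finsum_insert) auto
  have "span {u} = {lincomb a {u} | a. True}"
    using finite_span[of "{u}"] u by simp
  also have "\<dots> = {c \<cdot>\<^sub>v u | c. True}"
  proof (intro equalityI subsetI)
    fix z assume "z \<in> {c \<cdot>\<^sub>v u | c. True}"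
    then obtain c where "z = c \<cdot>\<^sub>v u" by blast
    then show "z \<in> {lincomb a {u} | a. True}"
      unfolding comb by (auto intro!: exI[of _ "\<lambda>_. c"])
  qed (auto simp: comb)
  finally show ?thesis .
qed

text \<open>If \<open>A z = 0\<close> then \<open>0 = X A z = z - (v \<bullet> z) u\<close>, so \<open>z\<close> is a multiple of \<open>u\<close>.\<close>

lemma mat_kernel_eq_span_singleton:
  assumes A: "A \<in> carrier_mat n n" and X: "X \<in> carrier_mat n n"
    and uv: "u \<in> carrier_vec n" "v \<in> carrier_vec n"
    and XA: "X * A = 1\<^sub>m n - outer_prod u v" and null: "A *\<^sub>v u = 0\<^sub>v n"
  shows "mat_kernel A = real_span n {u}"
proof -
  have "z = (v \<bullet> z) \<cdot>\<^sub>v u" if z: "z \<in> carrier_vec n" "A *\<^sub>v z = 0\<^sub>v n" for z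
  proof -
    have "0\<^sub>v n = (X * A) *\<^sub>v z"
      unfolding assoc_mult_mat_vec[OF X A z(1)] z(2) using X by (simp add: mult_mat_zero_vec[of _ n n])
    also have "\<dots> = z - (v \<bullet> z) \<cdot>\<^sub>v u"
      unfolding XA using uv z
      by (subst minus_mult_distrib_mat_vec[of _ n n]) (auto simp: outer_prod_mult_vec[of _ n])
    finally show ?thesis
      using uv z by (auto simp: vec_eq_iff)
  qed
  moreover have "A *\<^sub>v (c \<cdot>\<^sub>v u) = 0\<^sub>v n" for c
    using A uv null by (auto simp: mult_mat_vec[of _ n n] intro!: eq_vecI)
  ultimately show ?thesis
    unfolding mat_kernel[OF A] real_span_singleton[OF uv(1)] using uv(1) by auto
qed

text \<open>The products \<open>A X\<close> and \<open>X A\<close> are equal to an oblique projector, in general not symmetric.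
  Multiplying \<open>X\<close> by the orthogonal projectors repairs this: the left factor \<open>I - u u\<^sup>T / u\<^sup>T u\<close>
  is absorbed by \<open>A\<close> because \<open>A u = 0\<close>, and the right factor annihilates \<open>v\<close>, hence the
  term \<open>u v\<^sup>T\<close>. So \<open>A B\<close> and \<open>B A\<close> become orthogonal projectors, which gives all four
  Penrose conditions.\<close>

lemma projected_inverse:
  assumes A: "A \<in> carrier_mat n n" and X: "X \<in> carrier_mat n n"
    and uv: "u \<in> carrier_vec n" "v \<in> carrier_vec n" "u \<bullet> u \<noteq> 0" "v \<bullet> v \<noteq> 0"
    and AX: "A * X = 1\<^sub>m n - outer_prod u v" and XA: "X * A = 1\<^sub>m n - outer_prod u v"
    and null: "A *\<^sub>v u = 0\<^sub>v n" "transpose_mat A *\<^sub>v v = 0\<^sub>v n"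
    and B: "B = orth_proj n u * X * orth_proj n v"
  shows "A * B = orth_proj n v" "B * A = orth_proj n u" "pseudo_inverse A = B"
    "B *\<^sub>v v = 0\<^sub>v n" "transpose_mat B *\<^sub>v u = 0\<^sub>v n"
proof -
  note P = orth_proj_carrier[OF uv(1)] orth_proj_carrier[OF uv(2)]
  have PX: "orth_proj n u * X \<in> carrier_mat n n" "X * orth_proj n v \<in> carrier_mat n n"
    using P X by auto
  have c: "B \<in> carrier_mat n n" using PX P by (simp add: B)
  have APu: "A * orth_proj n u = A" and PvA: "orth_proj n v * A = A"
    using A uv null by (auto intro: mult_orth_proj orth_proj_mult)
  have "A * B = A * orth_proj n u * (X * orth_proj n v)"
    unfolding B using A X P PX by (simp add: assoc_mult_mat[of _ n n _ n _ n])
  also have "\<dots> = (1\<^sub>m n - outer_prod u v) * orth_proj n v"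
    unfolding APu AX[symmetric] using A X P by (simp add: assoc_mult_mat[of _ n n _ n _ n])
  also have "\<dots> = orth_proj n v - outer_prod u (orth_proj n v *\<^sub>v v)"
    using uv P
    by (subst minus_mult_distrib_mat[of _ n n _ _ n])
       (auto simp: left_mult_one_mat[of _ n n] outer_prod_mult[of _ n n] transpose_orth_proj)
  also have "\<dots> = orth_proj n v"
    using uv P unfolding orth_proj_mult_vec_self[OF uv(2,4)] by (intro eq_matI) auto
  finally show AB: "A * B = orth_proj n v" .
  have "B * A = orth_proj n u * X * (orth_proj n v * A)"
    unfolding B using A X P PX by (simp add: assoc_mult_mat[of _ n n _ n _ n])
  also have "\<dots> = orth_proj n u * (1\<^sub>m n - outer_prod u v)"
    unfolding PvA XA[symmetric] using A X P by (simp add: assoc_mult_mat[of _ n n _ n _ n])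
  also have "\<dots> = orth_proj n u - outer_prod (orth_proj n u *\<^sub>v u) v"
    using uv P
    by (subst mult_minus_distrib_mat[of _ n n _ n]) (auto simp: right_mult_one_mat[of _ n n] mult_outer_prod[of _ n n])
  also have "\<dots> = orth_proj n u"
    using uv P unfolding orth_proj_mult_vec_self[OF uv(1,3)] by (intro eq_matI) auto
  finally show BA: "B * A = orth_proj n u" .
  have "B * A * B = orth_proj n u * B"
    unfolding BA ..
  also have "\<dots> = orth_proj n u * orth_proj n u * X * orth_proj n v"
    unfolding B using X P PX by (simp add: assoc_mult_mat[of _ n n _ n _ n])
  also have "\<dots> = B"
    unfolding orth_proj_idem[OF uv(1,3)] B ..
  finally have "B * A * B = B" .
  then have "is_pseudo_inverse A B"
    using A c uv by (simp add: is_pseudo_inverse_def AB BA PvA transpose_orth_proj)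
  then show "pseudo_inverse A = B"
    by (rule pseudo_inverse_eqI)
  show "B *\<^sub>v v = 0\<^sub>v n"
    unfolding B using PX P uv
    by (subst assoc_mult_mat_vec[of _ n n _ n]) (auto simp: orth_proj_mult_vec_self)
  have "transpose_mat B = transpose_mat (X * orth_proj n v) * orth_proj n u"
    unfolding B assoc_mult_mat[OF P(1) X P(2)]
    by (subst transpose_mult[OF P(1) PX(2)]) (simp add: transpose_orth_proj[OF uv(1)])
  then show "transpose_mat B *\<^sub>v u = 0\<^sub>v n"
    using PX(2) assoc_mult_mat_vec[OF transpose_carrier_mat[THEN iffD2, OF PX(2)] P(1) uv(1)]
    by (simp add: orth_proj_mult_vec_self[OF uv(1,3)] mult_mat_zero_vec[of _ n n])
qed

lemma projected_inverse_expand: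
  assumes X: "X \<in> carrier_mat n n" and uv: "u \<in> carrier_vec n" "v \<in> carrier_vec n"
  shows "orth_proj n u * X * orth_proj n v
    = X - (1 / (u \<bullet> u)) \<cdot>\<^sub>m outer_prod u (transpose_mat X *\<^sub>v u)
        - (1 / (v \<bullet> v)) \<cdot>\<^sub>m outer_prod (X *\<^sub>v v) v
        + ((u \<bullet> (X *\<^sub>v v)) / ((u \<bullet> u) * (v \<bullet> v))) \<cdot>\<^sub>m outer_prod u v"
  using X uv
  unfolding orth_proj_def rank_one_downdate_eq[OF uv(1) uv(1)] rank_one_downdate_eq[OF uv(2) uv(2)]
    rank_one_update_mult_both[OF X uv(1,1,2,2)]
  by (intro eq_matI) auto

section \<open>The leading block of a matrix with known null vectors\<close>

text \<open>A null vector with nonzero last entry expresses the last column through the other columns,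
  and a left null vector does the same for the last row. So the leading block determines the
  whole matrix. The lemma is applied to \<open>A\<close> and, with the null vectors exchanged, to its
  pseudo-inverse.\<close>

lemma bordered_null_blocks:
  fixes M :: "real mat"
  assumes M: "M \<in> carrier_mat m m" and bc: "b \<in> carrier_vec m" "c \<in> carrier_vec m"
    and pq: "p \<in> carrier_vec m" "q \<in> carrier_vec m" "p0 \<noteq> 0" "q0 \<noteq> 0"
    and null: "bordered_mat M b c d *\<^sub>v (p @\<^sub>v vec_of_list [p0]) = 0\<^sub>v (Suc m)"
      "transpose_mat (bordered_mat M b c d) *\<^sub>v (q @\<^sub>v vec_of_list [q0]) = 0\<^sub>v (Suc m)"
  shows "b = (- 1 / p0) \<cdot>\<^sub>v (M *\<^sub>v p)" "c = (- 1 / q0) \<cdot>\<^sub>v (transpose_mat M *\<^sub>v q)"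
    "d = (q \<bullet> (M *\<^sub>v p)) / (p0 * q0)"
proof -
  have 1: "M *\<^sub>v p + p0 \<cdot>\<^sub>v b = 0\<^sub>v m" "c \<bullet> p + d * p0 = 0"
    using null(1) M bc pq unfolding bordered_mat_mult_vec[OF M bc pq(1)] zero_append_single
    by (subst (asm) append_single_eq_iff; simp)+
  have 2: "transpose_mat M *\<^sub>v q + q0 \<cdot>\<^sub>v c = 0\<^sub>v m"
    using null(2) M bc pq
    unfolding transpose_bordered_mat[OF M bc]
      bordered_mat_mult_vec[OF transpose_carrier_mat[THEN iffD2, OF M] bc(2,1) pq(2)] zero_append_single
    by (subst (asm) append_single_eq_iff; simp)
  have solve: "y = (- 1 / k) \<cdot>\<^sub>v x" if "x + k \<cdot>\<^sub>v y = 0\<^sub>v m" "k \<noteq> 0" "x \<in> carrier_vec m" "y \<in> carrier_vec m"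
    for x y :: "real vec" and k
  proof (rule eq_vecI)
    fix i assume "i < dim_vec ((- 1 / k) \<cdot>\<^sub>v x)"
    then have "x $ i + k * y $ i = 0"
      using arg_cong[OF that(1), of "\<lambda>z. z $ i"] that(3,4) by auto
    then show "y $ i = ((- 1 / k) \<cdot>\<^sub>v x) $ i"
      using that \<open>i < _\<close> by (simp add: field_simps)
  qed (use that in auto)
  show "b = (- 1 / p0) \<cdot>\<^sub>v (M *\<^sub>v p)"
    using 1 M bc pq by (intro solve) auto
  show c: "c = (- 1 / q0) \<cdot>\<^sub>v (transpose_mat M *\<^sub>v q)"
    using 2 M bc pq by (intro solve) auto
  have "c \<bullet> p = (- 1 / q0) * (q \<bullet> (M *\<^sub>v p))"
    unfolding c using M pq by (simp add: transpose_vec_mult_scalar[of _ m m])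
  moreover have "d = - (c \<bullet> p) / p0"
    using 1(2) pq by (simp add: field_simps)
  ultimately show "d = (q \<bullet> (M *\<^sub>v p)) / (p0 * q0)"
    by (simp add: mult.commute)
qed

text \<open>For \<open>c \<noteq> 0\<close>, the linear map that subtracts from a vector the multiple of \<open>(z, c)\<close> that
  makes its last entry zero, and then drops that entry. Its kernel is spanned by \<open>(z, c)\<close>.\<close>

definition eliminate_last :: "nat \<Rightarrow> real vec \<Rightarrow> real \<Rightarrow> real mat" where
  "eliminate_last m z c = 1\<^sub>m m @\<^sub>c mat_of_col ((- 1 / c) \<cdot>\<^sub>v z)"

lemma eliminate_last_carrier [simp]: "eliminate_last m z c \<in> carrier_mat m (Suc m)"
  by (simp add: eliminate_last_def)

lemma transpose_eliminate_last:
  "z \<in> carrier_vec m \<Longrightarrow>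
    transpose_mat (eliminate_last m z c) = 1\<^sub>m m @\<^sub>r mat_of_row ((- 1 / c) \<cdot>\<^sub>v z)"
  unfolding eliminate_last_def using transpose_append_col[of "1\<^sub>m m" m m "(- 1 / c) \<cdot>\<^sub>v z"] by simp

lemma eliminate_last_mult_vec:
  assumes "z \<in> carrier_vec m" "c \<noteq> 0"
  shows "eliminate_last m z c *\<^sub>v (z @\<^sub>v vec_of_list [c]) = 0\<^sub>v m"
  using assms append_col_mult_vec[of "1\<^sub>m m" m m "(- 1 / c) \<cdot>\<^sub>v z" z c]
  unfolding eliminate_last_def by (auto intro!: eq_vecI)

text \<open>By \<open>bordered_null_blocks\<close> the left-hand side is the general form of a matrix with null
  vectors \<open>(p, p0)\<close> on the right and \<open>(q, q0)\<close> on the left whose last entries are nonzero.\<close>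

lemma bordered_factorization:
  fixes M :: "real mat"
  assumes M: "M \<in> carrier_mat m m" and pq: "p \<in> carrier_vec m" "q \<in> carrier_vec m"
  shows "bordered_mat M ((- 1 / p0) \<cdot>\<^sub>v (M *\<^sub>v p)) ((- 1 / q0) \<cdot>\<^sub>v (transpose_mat M *\<^sub>v q))
      ((q \<bullet> (M *\<^sub>v p)) / (p0 * q0))
    = transpose_mat (eliminate_last m q q0) * M * eliminate_last m p p0"
proof -
  let ?r = "(- 1 / q0) \<cdot>\<^sub>v q" and ?e = "(- 1 / p0) \<cdot>\<^sub>v p"
  have r: "?r \<in> carrier_vec m" and e: "?e \<in> carrier_vec m"
    and Mr: "transpose_mat M *\<^sub>v ?r \<in> carrier_vec m" and Me: "M *\<^sub>v ?e \<in> carrier_vec m"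
    using M pq by auto
  have RM: "transpose_mat (eliminate_last m q q0) * M = M @\<^sub>r mat_of_row (transpose_mat M *\<^sub>v ?r)"
    unfolding transpose_eliminate_last[OF pq(2)]
    using append_row_mult[OF _ r M, of "1\<^sub>m m" m] M by simp
  have "transpose_mat (eliminate_last m q q0) * M * eliminate_last m p p0 = (M @\<^sub>r mat_of_row (transpose_mat M *\<^sub>v ?r))
      @\<^sub>c mat_of_col ((M @\<^sub>r mat_of_row (transpose_mat M *\<^sub>v ?r)) *\<^sub>v ?e)"
    unfolding RM unfolding eliminate_last_def
    using mult_append_col[of "M @\<^sub>r mat_of_row (transpose_mat M *\<^sub>v ?r)" "Suc m" m ?e "1\<^sub>m m" m] M e
      right_mult_one_mat[of "M @\<^sub>r mat_of_row (transpose_mat M *\<^sub>v ?r)" "Suc m" m]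
    by simp
  also have "\<dots> = bordered_mat M (M *\<^sub>v ?e) (transpose_mat M *\<^sub>v ?r) ((transpose_mat M *\<^sub>v ?r) \<bullet> ?e)"
    unfolding append_row_mult_vec[OF M Mr e] bordered_mat_eq_append_col[OF M Me Mr] ..
  also have "(transpose_mat M *\<^sub>v ?r) \<bullet> ?e = (q \<bullet> (M *\<^sub>v p)) / (p0 * q0)"
    unfolding transpose_vec_mult_scalar[OF M e r] using M pq
    by (simp add: mult_mat_vec[of _ m m])
  also have "M *\<^sub>v ?e = (- 1 / p0) \<cdot>\<^sub>v (M *\<^sub>v p)"
    using M pq by (intro mult_mat_vec)
  also have "transpose_mat M *\<^sub>v ?r = (- 1 / q0) \<cdot>\<^sub>v (transpose_mat M *\<^sub>v q)"
    using M pq by (intro mult_mat_vec) auto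
  finally show ?thesis ..
qed

lemma inv_mat_eqI:
  assumes A: "A \<in> carrier_mat n n" and X: "X \<in> carrier_mat n n" and AX: "A * X = 1\<^sub>m n"
  shows "invertible_mat A" "inv_mat A = X"
proof -
  have XA: "X * A = 1\<^sub>m n"
    by (rule mat_mult_left_right_inverse[OF A X AX])
  show inv: "invertible_mat A"
    using A X AX XA unfolding invertible_mat_def inverts_mat_def by auto
  note I = inv_mat_inverts[OF A inv]
  have "inv_mat A = inv_mat A * (A * X)"
    using I(1) by (simp add: AX)
  also have "\<dots> = X"
    using X by (simp add: assoc_mult_mat[OF I(1) A X, symmetric] I(3))
  finally show "inv_mat A = X" .
qed

text \<open>Write \<open>R\<close> for the transpose of the elimination matrix of \<open>(z, z0)\<close>. Then
  \<open>R (M L B R) = A B R = R\<close>, because the projector \<open>A B\<close> fixes the columns of \<open>R\<close>, which are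
  orthogonal to \<open>(z, z0)\<close>. Since \<open>R\<close> has the identity as its leading block, it can be
  cancelled on the left.\<close>

lemma leading_block_inverse:
  assumes M: "M \<in> carrier_mat m m" and B: "B \<in> carrier_mat (Suc m) (Suc m)"
    and z: "z \<in> carrier_vec m" "z0 \<noteq> 0" and L: "L \<in> carrier_mat m (Suc m)"
    and A: "A = transpose_mat (eliminate_last m z z0) * M * L"
    and AB: "A * B = orth_proj (Suc m) (z @\<^sub>v vec_of_list [z0])"
  shows "M * (L * B * transpose_mat (eliminate_last m z z0)) = 1\<^sub>m m"
proof -
  let ?R = "transpose_mat (eliminate_last m z z0)"
  let ?r = "(- 1 / z0) \<cdot>\<^sub>v z" and ?N = "M * (L * B * transpose_mat (eliminate_last m z z0))"
  have R: "?R \<in> carrier_mat (Suc m) m"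
    by simp
  have RM: "?R * M \<in> carrier_mat (Suc m) m"
    by (rule mult_carrier_mat[OF R M])
  have LBR: "L * B * ?R \<in> carrier_mat m m"
    by (rule mult_carrier_mat[OF mult_carrier_mat[OF L B] R])
  then have N: "?N \<in> carrier_mat m m"
    by (rule mult_carrier_mat[OF M])
  have "?R * ?N = ?R * M * (L * B * ?R)"
    by (rule assoc_mult_mat[OF R M LBR, symmetric])
  also have "\<dots> = ?R * M * (L * (B * ?R))"
    unfolding assoc_mult_mat[OF L B R] ..
  also have "\<dots> = A * (B * ?R)"
    unfolding A by (rule assoc_mult_mat[OF RM L, symmetric]) (use B R in auto)
  also have "\<dots> = A * B * ?R"
    by (rule assoc_mult_mat[OF _ B R, symmetric]) (use A RM L in auto)
  also have "\<dots> = ?R"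
    unfolding AB using R z
    by (intro orth_proj_mult[of _ _ m]) (auto simp: eliminate_last_mult_vec[simplified])
  finally have "?R * ?N = ?R" .
  moreover have "?R * ?N = ?N @\<^sub>r mat_of_row (transpose_mat ?N *\<^sub>v ?r)"
    unfolding transpose_eliminate_last[OF z(1)]
    using append_row_mult[of "1\<^sub>m m" m m ?r ?N m] N z left_mult_one_mat[OF N]
    unfolding transpose_eliminate_last[OF z(1)] by simp
  moreover have "?R = 1\<^sub>m m @\<^sub>r mat_of_row ?r"
    by (rule transpose_eliminate_last[OF z(1)])
  ultimately have "?N @\<^sub>r mat_of_row (transpose_mat ?N *\<^sub>v ?r) = 1\<^sub>m m @\<^sub>r mat_of_row ?r"
    by simp
  then show ?thesis
    using N z by (subst (asm) append_row_eq_iff[of _ m m]) auto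
qed

lemma eliminate_both_sides_bordered:
  fixes M :: "real mat"
  assumes M: "M \<in> carrier_mat m m" and bc: "b \<in> carrier_vec m" "c \<in> carrier_vec m"
    and pq: "p \<in> carrier_vec m" "q \<in> carrier_vec m"
  shows "eliminate_last m p p0 * bordered_mat M b c d * transpose_mat (eliminate_last m q q0)
    = M - (1 / p0) \<cdot>\<^sub>m outer_prod p c - (1 / q0) \<cdot>\<^sub>m outer_prod b q
        + (d / (p0 * q0)) \<cdot>\<^sub>m outer_prod p q"
proof -
  let ?r = "(- 1 / q0) \<cdot>\<^sub>v q" and ?e = "(- 1 / p0) \<cdot>\<^sub>v p"
  have r: "?r \<in> carrier_vec m" and e: "?e \<in> carrier_vec m"
    and cd: "c @\<^sub>v vec_of_list [d] \<in> carrier_vec (Suc m)"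
    and Mb: "M @\<^sub>c mat_of_col b \<in> carrier_mat m (Suc m)"
    using M pq bc by auto
  have "eliminate_last m p p0 * bordered_mat M b c d
      = 1\<^sub>m m * (M @\<^sub>c mat_of_col b) + outer_prod ?e (c @\<^sub>v vec_of_list [d])"
    unfolding eliminate_last_def bordered_mat_eq_append_row[OF M bc]
    by (rule append_col_mult_append_row[OF one_carrier_mat e Mb cd])
  also have "\<dots> = (M + outer_prod ?e c) @\<^sub>c mat_of_col (b + d \<cdot>\<^sub>v ?e)"
    using M bc pq left_mult_one_mat[OF Mb]
    by (intro eq_matI)
       (auto simp: index_append_col[of _ m m] index_append_single less_Suc_eq)
  also have "\<dots> * transpose_mat (eliminate_last m q q0)
      = (M + outer_prod ?e c) * 1\<^sub>m m + outer_prod (b + d \<cdot>\<^sub>v ?e) ?r"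
    unfolding transpose_eliminate_last[OF pq(2)]
    using M bc e r by (intro append_col_mult_append_row) auto
  also have "\<dots> = M - (1 / p0) \<cdot>\<^sub>m outer_prod p c - (1 / q0) \<cdot>\<^sub>m outer_prod b q
        + (d / (p0 * q0)) \<cdot>\<^sub>m outer_prod p q"
    using M bc pq by (subst right_mult_one_mat[of _ m m]) (auto intro!: eq_matI simp: algebra_simps)
  finally show ?thesis .
qed

section \<open>Recovering the pseudo-inverse from the leading block\<close>

text \<open>For nonzero \<open>s = z \<bullet> z + c\<^sup>2\<close> these are the leading \<open>m\<close> columns of the projector onto the
  orthogonal complement of \<open>(z, c)\<close>. The parameter \<open>s\<close> is kept separate because the
  multiplication by these columns is computed for every \<open>s\<close>.\<close>

definition orth_proj_leading :: "nat \<Rightarrow> real vec \<Rightarrow> real \<Rightarrow> real \<Rightarrow> real mat" where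
  "orth_proj_leading m z c s =
     (1\<^sub>m m - (1 / s) \<cdot>\<^sub>m outer_prod z z) @\<^sub>r mat_of_row ((- c / s) \<cdot>\<^sub>v z)"

lemma orth_proj_leading_carrier [simp]:
  "z \<in> carrier_vec m \<Longrightarrow> orth_proj_leading m z c s \<in> carrier_mat (Suc m) m"
  by (simp add: orth_proj_leading_def minus_carrier_mat)

lemma transpose_orth_proj_leading:
  assumes "z \<in> carrier_vec m"
  shows "transpose_mat (orth_proj_leading m z c s) =
    (1\<^sub>m m - (1 / s) \<cdot>\<^sub>m outer_prod z z) @\<^sub>c mat_of_col ((- c / s) \<cdot>\<^sub>v z)"
proof -
  have "transpose_mat (1\<^sub>m m - (1 / s) \<cdot>\<^sub>m outer_prod z z) = 1\<^sub>m m - (1 / s) \<cdot>\<^sub>m outer_prod z z"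
    using assms by (intro eq_matI) (auto simp: mult.commute)
  then show ?thesis
    unfolding orth_proj_leading_def
    using assms transpose_append_row[of "1\<^sub>m m - (1 / s) \<cdot>\<^sub>m outer_prod z z" m m "(- c / s) \<cdot>\<^sub>v z"]
    by (simp add: minus_carrier_mat)
qed

text \<open>The entry dropped by the elimination is zero, so that the leading columns of the projector
  act on the full vector, changed only by a multiple of \<open>(z, c)\<close>. The projector annihilates
  this multiple.\<close>

lemma orth_proj_leading_mult_eliminate_last:
  assumes z: "z \<in> carrier_vec m" and c: "c \<noteq> 0"
    and s: "s = (z @\<^sub>v vec_of_list [c]) \<bullet> (z @\<^sub>v vec_of_list [c])" "s \<noteq> 0"
  shows "orth_proj_leading m z c s * eliminate_last m z c = orth_proj (Suc m) (z @\<^sub>v vec_of_list [c])"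
proof -
  let ?X = "1\<^sub>m m - (1 / s) \<cdot>\<^sub>m outer_prod z z"
  let ?r = "(- c / s) \<cdot>\<^sub>v z" and ?e = "(- 1 / c) \<cdot>\<^sub>v z"
  have zz: "z \<bullet> z = s - c * c"
    unfolding s(1) scalar_prod_append_single[OF z z] by simp
  have X: "?X \<in> carrier_mat m m" and r: "?r \<in> carrier_vec m" and e: "?e \<in> carrier_vec m"
    using z by (auto simp: minus_carrier_mat)
  have "orth_proj_leading m z c s * eliminate_last m z c
      = (?X @\<^sub>r mat_of_row ?r) @\<^sub>c mat_of_col ((?X @\<^sub>r mat_of_row ?r) *\<^sub>v ?e)"
    unfolding orth_proj_leading_def eliminate_last_def
    using mult_append_col[of "?X @\<^sub>r mat_of_row ?r" "Suc m" m ?e "1\<^sub>m m" m] X z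
    by simp
  also have "(?X @\<^sub>r mat_of_row ?r) *\<^sub>v ?e = (?X *\<^sub>v ?e) @\<^sub>v vec_of_list [?r \<bullet> ?e]"
    by (rule append_row_mult_vec[OF X r e])
  also have "?X *\<^sub>v ?e = ?e + (- (1 / s) * (z \<bullet> ?e)) \<cdot>\<^sub>v z"
    unfolding rank_one_downdate_eq[OF z z] by (rule rank_one_update_mult_vec[OF z z e])
  also have "\<dots> = ?r"
    using z c s(2) by (intro eq_vecI) (auto simp: zz field_simps)
  also have "?r \<bullet> ?e = 1 - c * c / s"
    using z c s(2) by (auto simp: zz field_simps)
  also have "(?X @\<^sub>r mat_of_row ?r) @\<^sub>c mat_of_col (?r @\<^sub>v vec_of_list [1 - c * c / s])
      = bordered_mat ?X ?r ?r (1 - c * c / s)"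
    by (rule bordered_mat_eq_append_col[OF X r r, symmetric])
  also have "\<dots> = orth_proj (Suc m) (z @\<^sub>v vec_of_list [c])"
    unfolding orth_proj_def s(1)[symmetric] using z X r
    by (intro eq_matI) (auto simp: index_bordered_mat[of _ m m] index_append_single less_Suc_eq)
  finally show ?thesis .
qed

text \<open>A row-bordered matrix absorbs a factor on its right into both parts, and a column-bordered
  one absorbs a factor on its left, so the product is again a bordered matrix whose blocks can
  be read off.\<close>

lemma orth_proj_leading_sandwich:
  fixes M :: "real mat"
  assumes M: "M \<in> carrier_mat m m" and pq: "p \<in> carrier_vec m" "q \<in> carrier_vec m"
    and w: "w = (1 / k) \<cdot>\<^sub>v (M *\<^sub>v q)" and t: "t = (1 / s) \<cdot>\<^sub>v (transpose_mat M *\<^sub>v p)"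
  shows "orth_proj_leading m p p0 s * M * transpose_mat (orth_proj_leading m q q0 k)
    = bordered_mat
        (M - outer_prod p t - outer_prod w q + ((p \<bullet> w) / s) \<cdot>\<^sub>m outer_prod p q)
        ((q0 * ((p \<bullet> w) / s)) \<cdot>\<^sub>v p - q0 \<cdot>\<^sub>v w)
        ((p0 * ((p \<bullet> w) / s)) \<cdot>\<^sub>v q - p0 \<cdot>\<^sub>v t)
        (p0 * q0 * ((p \<bullet> w) / s))"
proof -
  let ?P = "1\<^sub>m m - (1 / s) \<cdot>\<^sub>m outer_prod p p" and ?Q = "1\<^sub>m m - (1 / k) \<cdot>\<^sub>m outer_prod q q"
  let ?r = "(- p0) \<cdot>\<^sub>v t" and ?e = "(- q0 / k) \<cdot>\<^sub>v q"
  have P: "?P \<in> carrier_mat m m" and Q: "?Q \<in> carrier_mat m m"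
    and r: "?r \<in> carrier_vec m" and e: "?e \<in> carrier_vec m"
    and PM: "?P * M \<in> carrier_mat m m" and PMQ: "?P * M * ?Q \<in> carrier_mat m m"
    and wt: "w \<in> carrier_vec m" "t \<in> carrier_vec m"
    using M pq by (auto simp: minus_carrier_mat w t)
  have tq: "(t \<bullet> q) / k = (p \<bullet> w) / s"
    unfolding t w using M pq by (simp add: transpose_vec_mult_scalar[of _ m m])
  have "transpose_mat M *\<^sub>v ((- p0 / s) \<cdot>\<^sub>v p) = ?r"
    unfolding t using M pq by (subst mult_mat_vec[of _ m m]) (auto intro!: eq_vecI)
  then have SM: "orth_proj_leading m p p0 s * M = (?P * M) @\<^sub>r mat_of_row ?r"
    unfolding orth_proj_leading_def using append_row_mult[OF P _ M, of "(- p0 / s) \<cdot>\<^sub>v p"] pq by simp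
  have "orth_proj_leading m p p0 s * M * transpose_mat (orth_proj_leading m q q0 k)
      = (((?P * M) @\<^sub>r mat_of_row ?r) * ?Q) @\<^sub>c mat_of_col (((?P * M) @\<^sub>r mat_of_row ?r) *\<^sub>v ?e)"
    unfolding SM transpose_orth_proj_leading[OF pq(2)]
    using PM e Q by (intro mult_append_col[of _ "Suc m" m]) auto
  also have "((?P * M) @\<^sub>r mat_of_row ?r) * ?Q = (?P * M * ?Q) @\<^sub>r mat_of_row (transpose_mat ?Q *\<^sub>v ?r)"
    by (rule append_row_mult[OF PM r Q])
  also have "((?P * M) @\<^sub>r mat_of_row ?r) *\<^sub>v ?e = (?P * M *\<^sub>v ?e) @\<^sub>v vec_of_list [?r \<bullet> ?e]"
    by (rule append_row_mult_vec[OF PM r e])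
  also have "((?P * M * ?Q) @\<^sub>r mat_of_row (transpose_mat ?Q *\<^sub>v ?r))
      @\<^sub>c mat_of_col ((?P * M *\<^sub>v ?e) @\<^sub>v vec_of_list [?r \<bullet> ?e])
      = bordered_mat (?P * M * ?Q) (?P * M *\<^sub>v ?e) (transpose_mat ?Q *\<^sub>v ?r) (?r \<bullet> ?e)"
    using PM Q PMQ e r
    by (subst bordered_mat_eq_append_col[of _ m m]) auto
  also have "?P * M * ?Q = M - outer_prod p t - outer_prod w q + ((p \<bullet> w) / s) \<cdot>\<^sub>m outer_prod p q"
    unfolding rank_one_downdate_eq[OF pq(1,1)] rank_one_downdate_eq[OF pq(2,2)]
      rank_one_update_mult_both[OF M pq(1,1,2,2)]
    unfolding w t using M pq by (intro eq_matI) auto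
  also have "?P * M *\<^sub>v ?e = ?P *\<^sub>v ((- q0) \<cdot>\<^sub>v w)"
    unfolding w using M P pq e
    by (subst assoc_mult_mat_vec[of _ m m _ m])
       (auto simp: mult_mat_vec[of _ m m] smult_smult_assoc)
  also have "\<dots> = (q0 * ((p \<bullet> w) / s)) \<cdot>\<^sub>v p - q0 \<cdot>\<^sub>v w"
    unfolding rank_one_downdate_eq[OF pq(1,1)] using pq wt
    by (subst rank_one_update_mult_vec) (auto intro!: eq_vecI)
  also have "transpose_mat ?Q = ?Q"
    using pq by (intro eq_matI) (auto simp: mult.commute)
  also have "?Q *\<^sub>v ?r = (p0 * ((t \<bullet> q) / k)) \<cdot>\<^sub>v q - p0 \<cdot>\<^sub>v t"
    unfolding rank_one_downdate_eq[OF pq(2,2)] using pq wt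
    by (subst rank_one_update_mult_vec) (auto intro!: eq_vecI simp: comm_scalar_prod[of q m t])
  also have "?r \<bullet> ?e = p0 * q0 * ((t \<bullet> q) / k)"
    using pq wt by simp
  finally show ?thesis unfolding tq .
qed

section \<open>Null spaces, pseudo-inverse and leading block\<close>

theorem theorem4:
  fixes n :: nat
    and A B C A11 B11 :: "real mat"
    and u v u1 v1 a12 a21 b12 b21 x y w t :: "real vec"
    and \<alpha> un vn ann bnn :: real
  assumes n: "n \<ge> 2"
    and C: "C \<in> carrier_mat n n" "invertible_mat C"
    and uv: "u \<in> carrier_vec n" "v \<in> carrier_vec n"
    and A: "A = C - \<alpha> \<cdot>\<^sub>m outer_prod u v" "\<not> invertible_mat A"
    and null: "A *\<^sub>v u = 0\<^sub>v n" "transpose_mat A *\<^sub>v v = 0\<^sub>v n"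
    and vu: "v \<bullet> u = 1"
    and A_part: "A11 \<in> carrier_mat (n - 1) (n - 1)"
      "a12 \<in> carrier_vec (n - 1)" "a21 \<in> carrier_vec (n - 1)"
      "A = bordered_mat A11 a12 a21 ann"
    and uv_part: "u1 \<in> carrier_vec (n - 1)" "v1 \<in> carrier_vec (n - 1)"
      "u = u1 @\<^sub>v vec_of_list [un]" "v = v1 @\<^sub>v vec_of_list [vn]"
    and pos: "un > 0" "vn > 0"
    and B: "B = (1\<^sub>m n - (1 / (u \<bullet> u)) \<cdot>\<^sub>m outer_prod u u) * inv_mat C
                  * (1\<^sub>m n - (1 / (v \<bullet> v)) \<cdot>\<^sub>m outer_prod v v)"
    and B_part: "B11 \<in> carrier_mat (n - 1) (n - 1)"
      "b12 \<in> carrier_vec (n - 1)" "b21 \<in> carrier_vec (n - 1)"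
      "B = bordered_mat B11 b12 b21 bnn"
    and y: "y = transpose_mat (inv_mat C) *\<^sub>v u"
    and x: "x = inv_mat C *\<^sub>v v"
    and w: "w = (1 / (v \<bullet> v)) \<cdot>\<^sub>v (inv_mat A11 *\<^sub>v v1)"
    and t: "t = (1 / (u \<bullet> u)) \<cdot>\<^sub>v (transpose_mat (inv_mat A11) *\<^sub>v u1)"
  shows "
     (mat_kernel A = real_span n {u} \<and>
      mat_kernel (transpose_mat A) = real_span n {v} \<and>
      pseudo_inverse A = B \<and>
      B = inv_mat C - (1 / (u \<bullet> u)) \<cdot>\<^sub>m outer_prod u y - (1 / (v \<bullet> v)) \<cdot>\<^sub>m outer_prod x v
            + ((u \<bullet> x) / ((u \<bullet> u) * (v \<bullet> v))) \<cdot>\<^sub>m outer_prod u v)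
   \<and> (invertible_mat A11 \<and>
      inv_mat A11 = (1\<^sub>m (n - 1) + (1 / un\<^sup>2) \<cdot>\<^sub>m outer_prod u1 u1) * B11
                      * (1\<^sub>m (n - 1) + (1 / vn\<^sup>2) \<cdot>\<^sub>m outer_prod v1 v1) \<and>
      inv_mat A11 = (1\<^sub>m (n - 1) @\<^sub>c mat_of_col ((- 1 / un) \<cdot>\<^sub>v u1)) * B
                      * (1\<^sub>m (n - 1) @\<^sub>r mat_of_row ((- 1 / vn) \<cdot>\<^sub>v v1)) \<and>
      inv_mat A11 = B11 - (1 / un) \<cdot>\<^sub>m outer_prod u1 b21 - (1 / vn) \<cdot>\<^sub>m outer_prod b12 v1
                      + (bnn / (un * vn)) \<cdot>\<^sub>m outer_prod u1 v1)
   \<and> (A = bordered_mat A11 ((- 1 / un) \<cdot>\<^sub>v (A11 *\<^sub>v u1))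
                           ((- 1 / vn) \<cdot>\<^sub>v (transpose_mat A11 *\<^sub>v v1))
                           ((v1 \<bullet> (A11 *\<^sub>v u1)) / (un * vn)) \<and>
      A = (1\<^sub>m (n - 1) @\<^sub>r mat_of_row ((- 1 / vn) \<cdot>\<^sub>v v1)) * A11
            * (1\<^sub>m (n - 1) @\<^sub>c mat_of_col ((- 1 / un) \<cdot>\<^sub>v u1)) \<and>
      B = ((1\<^sub>m (n - 1) - (1 / (u \<bullet> u)) \<cdot>\<^sub>m outer_prod u1 u1)
             @\<^sub>r mat_of_row ((- un / (u \<bullet> u)) \<cdot>\<^sub>v u1))
          * inv_mat A11
          * ((1\<^sub>m (n - 1) - (1 / (v \<bullet> v)) \<cdot>\<^sub>m outer_prod v1 v1)
             @\<^sub>c mat_of_col ((- vn / (v \<bullet> v)) \<cdot>\<^sub>v v1)) \<and>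
      B11 = inv_mat A11 - outer_prod u1 t - outer_prod w v1
              + ((u1 \<bullet> w) / (u \<bullet> u)) \<cdot>\<^sub>m outer_prod u1 v1 \<and>
      b12 = (vn * ((u1 \<bullet> w) / (u \<bullet> u))) \<cdot>\<^sub>v u1 - vn \<cdot>\<^sub>v w \<and>
      b21 = (un * ((u1 \<bullet> w) / (u \<bullet> u))) \<cdot>\<^sub>v v1 - un \<cdot>\<^sub>v t \<and>
      bnn = un * vn * ((u1 \<bullet> w) / (u \<bullet> u)))"
proof -
  define m where "m = n - 1"
  have nm: "n = Suc m" and n1: "n - 1 = m" using n by (auto simp: m_def)
  define X where "X = inv_mat C"
  note X = inv_mat_inverts[OF C, folded X_def]
  have Ac: "A \<in> carrier_mat n n" using C uv unfolding A by (simp add: minus_carrier_mat)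
  have uu: "u \<bullet> u = u1 \<bullet> u1 + un * un" and vv: "v \<bullet> v = v1 \<bullet> v1 + vn * vn"
    unfolding uv_part(3,4) by (rule scalar_prod_append_single; rule uv_part)+
  have "u1 \<bullet> u1 \<ge> 0" "v1 \<bullet> v1 \<ge> 0"
    by (auto simp: scalar_prod_def intro: sum_nonneg)
  then have pos': "u \<bullet> u > 0" "v \<bullet> v > 0"
    unfolding uu vv using pos by (auto intro!: add_nonneg_pos)
  have ne: "u \<bullet> u \<noteq> 0" "v \<bullet> v \<noteq> 0" "un \<noteq> 0" "vn \<noteq> 0" using pos pos' by auto

  \<comment> \<open>Both products of \<open>A\<close> with \<open>X = inv_mat C\<close> are the same oblique projector; part (a) follows from this.\<close>
  have XA: "X * A = 1\<^sub>m n - outer_prod u v"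
    unfolding A(1) using null C X uv vu by (intro rank_one_perturbed_inverse) (auto simp: A(1))
  have AX: "A * X = 1\<^sub>m n - outer_prod u v"
    unfolding A(1) using null C X uv vu by (intro rank_one_perturbed_inverse_right) (auto simp: A(1))
  have B': "B = orth_proj n u * X * orth_proj n v"
    unfolding B orth_proj_def X_def ..
  note P = projected_inverse[OF Ac X(1) uv ne(1,2) AX XA null B']

  have kerA: "mat_kernel A = real_span n {u}"
    by (rule mat_kernel_eq_span_singleton[OF Ac X(1) uv XA null(1)])
  have "transpose_mat X * transpose_mat A = transpose_mat (A * X)"
    by (rule transpose_mult[OF Ac X(1), symmetric])
  also have "\<dots> = 1\<^sub>m n - outer_prod v u"
    unfolding AX using uv by (intro eq_matI) auto
  finally have kerAT: "mat_kernel (transpose_mat A) = real_span n {v}"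
    using Ac X(1) uv null(2) by (intro mat_kernel_eq_span_singleton[where X = "transpose_mat X"]) auto
  have Bexp: "B = X - (1 / (u \<bullet> u)) \<cdot>\<^sub>m outer_prod u y - (1 / (v \<bullet> v)) \<cdot>\<^sub>m outer_prod x v
            + ((u \<bullet> x) / ((u \<bullet> u) * (v \<bullet> v))) \<cdot>\<^sub>m outer_prod u v"
    unfolding B' x y X_def[symmetric] by (rule projected_inverse_expand[OF X(1) uv])

  let ?L = "eliminate_last m u1 un" and ?R = "transpose_mat (eliminate_last m v1 vn)"
  let ?S = "orth_proj_leading m u1 un (u \<bullet> u)" and ?T = "transpose_mat (orth_proj_leading m v1 vn (v \<bullet> v))"
  note c1 = A_part(1-3)[unfolded n1] note c2 = B_part(1-3)[unfolded n1]
  note c3 = uv_part(1,2)[unfolded n1]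
  have Bc: "B \<in> carrier_mat (Suc m) (Suc m)"
    unfolding B_part(4) using c2(1) by (intro carrier_matI) auto
  note Ab = bordered_null_blocks[OF c1 c3 ne(3,4),
      OF null[unfolded nm A_part(4), unfolded uv_part(3,4)]]
  note Bb = bordered_null_blocks[OF c2 c3(2,1) ne(4,3),
      OF P(4,5)[unfolded nm B_part(4), unfolded uv_part(3,4)]]
  have Abord: "A = bordered_mat A11 ((- 1 / un) \<cdot>\<^sub>v (A11 *\<^sub>v u1))
      ((- 1 / vn) \<cdot>\<^sub>v (transpose_mat A11 *\<^sub>v v1)) ((v1 \<bullet> (A11 *\<^sub>v u1)) / (un * vn))"
    unfolding A_part(4) Ab(1)[symmetric] Ab(2)[symmetric] Ab(3)[symmetric] ..
  then have Afac: "A = ?R * A11 * ?L"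
    unfolding bordered_factorization[OF c1(1) c3] .
  \<comment> \<open>The inverse of \<open>A11\<close> is \<open>B\<close> compressed by the same factors that expand \<open>A11\<close> to \<open>A\<close>.\<close>
  define Y where "Y = ?L * B * ?R"
  have Yc: "Y \<in> carrier_mat m m" unfolding Y_def
    by (intro mult_carrier_mat[of _ m "Suc m"] Bc) auto
  have "A11 * Y = 1\<^sub>m m"
    unfolding Y_def using P(1)[unfolded nm uv_part(4)]
    by (intro leading_block_inverse[OF c1(1) Bc c3(2) ne(4) _ Afac]) auto
  note I = inv_mat_eqI[OF c1(1) Yc this]
  have Y3: "Y = B11 - (1 / un) \<cdot>\<^sub>m outer_prod u1 b21 - (1 / vn) \<cdot>\<^sub>m outer_prod b12 v1
                      + (bnn / (un * vn)) \<cdot>\<^sub>m outer_prod u1 v1"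
    unfolding Y_def B_part(4) by (rule eliminate_both_sides_bordered[OF c2 c3])
  have Y1: "(1\<^sub>m m + (1 / un\<^sup>2) \<cdot>\<^sub>m outer_prod u1 u1) * B11
                      * (1\<^sub>m m + (1 / vn\<^sup>2) \<cdot>\<^sub>m outer_prod v1 v1) = Y"
    unfolding rank_one_update_mult_both[OF c2(1) c3(1,1,2,2)] Y3
    unfolding Bb using c2(1) c3
    by (intro eq_matI) (auto simp: power2_eq_square mult.commute)

  \<comment> \<open>Conversely, the projectors absorbed by \<open>B\<close> factor through the elimination matrices, so
    that \<open>B\<close> is recovered from \<open>Y\<close>.\<close>
  have SL: "?S * ?L = orth_proj n u"
    unfolding nm uv_part(3)
    by (rule orth_proj_leading_mult_eliminate_last[OF c3(1) ne(3) refl ne(1)[unfolded uv_part(3)]])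
  have "orth_proj_leading m v1 vn (v \<bullet> v) * eliminate_last m v1 vn = orth_proj n v"
    unfolding nm uv_part(4)
    by (rule orth_proj_leading_mult_eliminate_last[OF c3(2) ne(4) refl ne(2)[unfolded uv_part(4)]])
  then have RT: "?R * ?T = orth_proj n v"
    using transpose_orth_proj[OF uv(2)] c3(2)
    by (metis transpose_mult eliminate_last_carrier orth_proj_leading_carrier)
  have Sc: "?S \<in> carrier_mat n m" and Tc: "?T \<in> carrier_mat m n"
    and Lc: "?L \<in> carrier_mat m n" and Rc: "?R \<in> carrier_mat n m"
    using c3 nm by auto
  have Bn: "B \<in> carrier_mat n n" using Bc nm by simp
  have BL: "?L * B \<in> carrier_mat m n" using Lc Bn by simp
  have "?S * Y * ?T = ?S * (?L * B) * ?R * ?T"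
    unfolding Y_def by (simp only: assoc_mult_mat[OF Sc BL Rc])
  also have "\<dots> = ?S * ?L * B * (?R * ?T)"
    unfolding assoc_mult_mat[OF Sc Lc Bn, symmetric]
    by (rule assoc_mult_mat) (use Sc Lc Bn Rc Tc in auto)
  also have "\<dots> = orth_proj n u * B * orth_proj n v"
    unfolding SL RT ..
  also have "\<dots> = B"
    using orth_proj_mult[OF Bn uv(1) P(5)] mult_orth_proj[OF Bn uv(2) P(4)] by simp
  finally have Bfac: "B = ?S * Y * ?T" ..

  have w': "w = (1 / (v \<bullet> v)) \<cdot>\<^sub>v (Y *\<^sub>v v1)" and t': "t = (1 / (u \<bullet> u)) \<cdot>\<^sub>v (transpose_mat Y *\<^sub>v u1)"
    unfolding w t I(2) by auto
  have wt: "w \<in> carrier_vec m" "t \<in> carrier_vec m" unfolding w' t' using Yc c3 by auto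
  have blocks: "B11 = Y - outer_prod u1 t - outer_prod w v1 + ((u1 \<bullet> w) / (u \<bullet> u)) \<cdot>\<^sub>m outer_prod u1 v1 \<and>
      b12 = (vn * ((u1 \<bullet> w) / (u \<bullet> u))) \<cdot>\<^sub>v u1 - vn \<cdot>\<^sub>v w \<and>
      b21 = (un * ((u1 \<bullet> w) / (u \<bullet> u))) \<cdot>\<^sub>v v1 - un \<cdot>\<^sub>v t \<and>
      bnn = un * vn * ((u1 \<bullet> w) / (u \<bullet> u))"
    using Bfac[unfolded orth_proj_leading_sandwich[OF Yc c3 w' t'] B_part(4)] c2 c3 Yc wt
    by (subst (asm) bordered_mat_eq_iff[of _ m m]) (auto simp: minus_carrier_mat)

  show ?thesis
    unfolding n1 I(2) X_def[symmetric]
    using kerA kerAT P(3) Bexp I(1) Y1[symmetric] Y_def Y3 Abord Afac Bfac blocks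
    unfolding transpose_eliminate_last[OF c3(2)] transpose_orth_proj_leading[OF c3(2)]
    unfolding eliminate_last_def orth_proj_leading_def
    by (elim conjE, intro conjI) assumption+
qed

end
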